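(* Let $\lambda$ be an eigenvalue of the pair $(E,A)$ with associated right and left eigenvectors $v$ and $w$, i.e. $\lambda E v = A v$ and $\lambda w^{\dagger}E = w^{\dagger}A$. Set $$\rho = \frac{w^{\dagger} Q v}{w^{\dagger}(E-Q)v}.$$ Then there is $\delta>0$ such that, if $|\lambda_0-\lambda|<\delta$, the sequence $(\lambda_j)_{j\ge 0}$ generated by the iteration (Algorithm 3) described in the context converges to $\lambda$ whenever $|\rho|>1$. Furthermore, the error $\epsilon_j=\lambda_j-\lambda$ fulfills $$\epsilon_j = -\rho^{-1}\,\epsilon_{j-1} + o(\epsilon_{j-1}).$$
   Context: $A$ and $E$ are real $m\times m$ matrices, $E$ being a symmetric, possibly singular, projection: $E^2=E=E^T$. The superscript $\dagger$ denotes the Hermitian conjugate. $\mathcal E$ and $\mathcal F$ are fixed $m\times n$ complex matrices normalized by $\mathcal F^{\dagger}E\mathcal E=I_n$. Define $$Q=E\mathcal E\mathcal F^{\dagger}E,\qquad P=I_m-Q,\qquad [A,Q]_+=AQ+QA,$$ $$A_{rr}=\mathcal F^{\dagger}A\mathcal E,\qquad H(\mu)=\mathcal F^{\dagger}AP\{\mu E-A+[A,Q]_+\}^{-1}PA\mathcal E .$$ Standing assumptions: the matrix $\lambda E-A+[A,Q]_+$ is invertible (hence so is $\mu E-A+[A,Q]_+$ for $\mu$ near $\lambda$); the pencil $\mu E-A$ is regular (invertible for all but finitely many $\mu$) and $\lambda$ is a simple eigenvalue of it. If $w^{\dagger}(E-Q)v=0$ and $w^\dagger Qv\neq 0$, one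 reads $|\rho|=\infty$ and $\rho^{-1}=0$. Iteration (Algorithm 3): starting from an initial value $\lambda_0$, for $j=1,2,\dots$ compute $H(\lambda_{j-1})$, compute the eigenvalues and the right and left eigenvectors of the $n\times n$ matrix $A_{rr}+H(\lambda_{j-1})$, and let $\lambda_j$ be the selected ("interesting") eigenvalue of this matrix, with right and left eigenvectors $\alpha_j,\beta_j$. The selected eigenvalue is the one corresponding to the sought mode, i.e. the eigenvalue of $A_{rr}+H(\lambda_{j-1})$ closest to $\lambda$ (note that $\lambda$ is an eigenvalue of $A_{rr}+H(\lambda)$). *)

theory Defs
  imports "HOL-Analysis.Analysis" "HOL-Computational_Algebra.Polynomial"
    "HOL-Library.Landau_Symbols"
begin

text \<open>An \<open>m \<times> n\<close> matrix has type \<open>_ ^ 'n ^ 'm\<close>. A scalar multiple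
  of a matrix is written \<open>mat \<mu> ** M\<close>, since \<open>*s\<close> only scales vectors.\<close>

abbreviation cmat :: "real ^ 'n ^ 'm \<Rightarrow> complex ^ 'n ^ 'm" where
  "cmat \<equiv> map_matrix complex_of_real"

definition hconj :: "complex ^ 'n ^ 'm \<Rightarrow> complex ^ 'm ^ 'n" where
  "hconj M = (\<chi> i j. cnj (M $ j $ i))"

text \<open>The row vector \<open>w\<^sup>\<dagger>\<close>; row-vector-matrix products are written with \<open>v*\<close>.\<close>

definition vconj :: "complex ^ 'm \<Rightarrow> complex ^ 'm" where
  "vconj w = (\<chi> i. cnj (w $ i))"

text \<open>The scalar \<open>w\<^sup>\<dagger> M v\<close>. The library's \<open>\<bullet>\<close> on complex vectors is the
  real inner product and cannot be used here.\<close>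

definition sesq :: "complex ^ 'm \<Rightarrow> complex ^ 'm ^ 'm \<Rightarrow> complex ^ 'm \<Rightarrow> complex" where
  "sesq w M v = (\<Sum>i\<in>UNIV. vconj w $ i * (M *v v) $ i)"

definition right_eigenvector :: "complex ^ 'n ^ 'n \<Rightarrow> complex \<Rightarrow> complex ^ 'n \<Rightarrow> bool" where
  "right_eigenvector M \<mu> x \<longleftrightarrow> x \<noteq> 0 \<and> M *v x = \<mu> *s x"

definition left_eigenvector :: "complex ^ 'n ^ 'n \<Rightarrow> complex \<Rightarrow> complex ^ 'n \<Rightarrow> bool" where
  "left_eigenvector M \<mu> y \<longleftrightarrow> y \<noteq> 0 \<and> vconj y v* M = \<mu> *s vconj y"

definition eigenvalue :: "complex ^ 'n ^ 'n \<Rightarrow> complex \<Rightarrow> bool" where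
  "eigenvalue M \<mu> \<longleftrightarrow> (\<exists>x. right_eigenvector M \<mu> x)"

definition pencil :: "real ^ 'm ^ 'm \<Rightarrow> real ^ 'm ^ 'm \<Rightarrow> complex \<Rightarrow> complex ^ 'm ^ 'm" where
  "pencil E A \<mu> = mat \<mu> ** cmat E - cmat A"

definition regular_pencil :: "real ^ 'm ^ 'm \<Rightarrow> real ^ 'm ^ 'm \<Rightarrow> bool" where
  "regular_pencil E A \<longleftrightarrow> finite {\<mu>. \<not> invertible (pencil E A \<mu>)}"

text \<open>\<open>det (\<mu> E - A)\<close> as a polynomial in \<open>\<mu>\<close>.\<close>

definition pencil_poly :: "real ^ 'm ^ 'm \<Rightarrow> real ^ 'm ^ 'm \<Rightarrow> complex poly" where
  "pencil_poly E A = det (\<chi> i j. [: - cmat A $ i $ j, cmat E $ i $ j :])"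

definition simple_pencil_eigenvalue ::
    "real ^ 'm ^ 'm \<Rightarrow> real ^ 'm ^ 'm \<Rightarrow> complex \<Rightarrow> bool" where
  "simple_pencil_eigenvalue E A lam \<longleftrightarrow> order lam (pencil_poly E A) = 1"

definition pencil_right_eigenvector ::
    "real ^ 'm ^ 'm \<Rightarrow> real ^ 'm ^ 'm \<Rightarrow> complex \<Rightarrow> complex ^ 'm \<Rightarrow> bool" where
  "pencil_right_eigenvector E A lam v \<longleftrightarrow>
     v \<noteq> 0 \<and> lam *s (cmat E *v v) = cmat A *v v"

definition pencil_left_eigenvector ::
    "real ^ 'm ^ 'm \<Rightarrow> real ^ 'm ^ 'm \<Rightarrow> complex \<Rightarrow> complex ^ 'm \<Rightarrow> bool" where
  "pencil_left_eigenvector E A lam w \<longleftrightarrow>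
     w \<noteq> 0 \<and> lam *s (vconj w v* cmat E) = vconj w v* cmat A"

definition Qmat ::
    "real ^ 'm ^ 'm \<Rightarrow> complex ^ 'n ^ 'm \<Rightarrow> complex ^ 'n ^ 'm \<Rightarrow> complex ^ 'm ^ 'm" where
  "Qmat E \<E> \<F> = cmat E ** \<E> ** hconj \<F> ** cmat E"

definition Pmat ::
    "real ^ 'm ^ 'm \<Rightarrow> complex ^ 'n ^ 'm \<Rightarrow> complex ^ 'n ^ 'm \<Rightarrow> complex ^ 'm ^ 'm" where
  "Pmat E \<E> \<F> = mat 1 - Qmat E \<E> \<F>"

definition anticomm :: "complex ^ 'm ^ 'm \<Rightarrow> complex ^ 'm ^ 'm \<Rightarrow> complex ^ 'm ^ 'm" where
  "anticomm A Q = A ** Q + Q ** A"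

definition Kmat ::
    "real ^ 'm ^ 'm \<Rightarrow> real ^ 'm ^ 'm \<Rightarrow> complex ^ 'n ^ 'm \<Rightarrow> complex ^ 'n ^ 'm
      \<Rightarrow> complex \<Rightarrow> complex ^ 'm ^ 'm" where
  "Kmat A E \<E> \<F> \<mu> = mat \<mu> ** cmat E - cmat A + anticomm (cmat A) (Qmat E \<E> \<F>)"

definition Arr ::
    "real ^ 'm ^ 'm \<Rightarrow> complex ^ 'n ^ 'm \<Rightarrow> complex ^ 'n ^ 'm \<Rightarrow> complex ^ 'n ^ 'n" where
  "Arr A \<E> \<F> = hconj \<F> ** cmat A ** \<E>"

definition Hmat ::
    "real ^ 'm ^ 'm \<Rightarrow> real ^ 'm ^ 'm \<Rightarrow> complex ^ 'n ^ 'm \<Rightarrow> complex ^ 'n ^ 'm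
      \<Rightarrow> complex \<Rightarrow> complex ^ 'n ^ 'n" where
  "Hmat A E \<E> \<F> \<mu> =
     hconj \<F> ** cmat A ** Pmat E \<E> \<F> ** matrix_inv (Kmat A E \<E> \<F> \<mu>)
       ** Pmat E \<E> \<F> ** cmat A ** \<E>"

text \<open>One step from \<open>\<mu>\<close> to \<open>\<nu>\<close>: \<open>\<nu>\<close> is an eigenvalue of \<open>A\<^sub>r\<^sub>r + H(\<mu>)\<close> closest
  to the sought \<open>lam\<close>. This is a relation, so that every way of breaking ties is covered.\<close>

definition iteration_step ::
    "real ^ 'm ^ 'm \<Rightarrow> real ^ 'm ^ 'm \<Rightarrow> complex ^ 'n ^ 'm \<Rightarrow> complex ^ 'n ^ 'm
      \<Rightarrow> complex \<Rightarrow> complex \<Rightarrow> complex \<Rightarrow> bool" where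
  "iteration_step A E \<E> \<F> lam \<mu> \<nu> \<longleftrightarrow>
     is_arg_min (\<lambda>z. cmod (z - lam)) (eigenvalue (Arr A \<E> \<F> + Hmat A E \<E> \<F> \<mu>)) \<nu>"

text \<open>A run of the iteration, from the initial value \<open>l 0\<close>; \<open>\<alpha> 0\<close> and \<open>\<beta> 0\<close> are unused.\<close>

definition iteration_run ::
    "real ^ 'm ^ 'm \<Rightarrow> real ^ 'm ^ 'm \<Rightarrow> complex ^ 'n ^ 'm \<Rightarrow> complex ^ 'n ^ 'm
      \<Rightarrow> complex \<Rightarrow> (nat \<Rightarrow> complex) \<Rightarrow> (nat \<Rightarrow> complex ^ 'n) \<Rightarrow> (nat \<Rightarrow> complex ^ 'n)
      \<Rightarrow> bool" where
  "iteration_run A E \<E> \<F> lam l \<alpha> \<beta> \<longleftrightarrow>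
     (\<forall>j. iteration_step A E \<E> \<F> lam (l j) (l (Suc j)) \<and>
          right_eigenvector (Arr A \<E> \<F> + Hmat A E \<E> \<F> (l j)) (l (Suc j)) (\<alpha> (Suc j)) \<and>
          left_eigenvector (Arr A \<E> \<F> + Hmat A E \<E> \<F> (l j)) (l (Suc j)) (\<beta> (Suc j)))"

text \<open>\<open>rho\<close> is meaningful only if its denominator is nonzero. The case of a zero
  denominator and nonzero numerator, read as \<open>\<bar>\<rho>\<bar> = \<infinity>\<close> and \<open>\<rho>\<^sup>-\<^sup>1 = 0\<close>, is dealt
  with in \<open>rho_abs\<close> and \<open>rho_inv\<close>.\<close>

definition rho ::
    "real ^ 'm ^ 'm \<Rightarrow> complex ^ 'n ^ 'm \<Rightarrow> complex ^ 'n ^ 'm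
      \<Rightarrow> complex ^ 'm \<Rightarrow> complex ^ 'm \<Rightarrow> complex" where
  "rho E \<E> \<F> v w =
     sesq w (Qmat E \<E> \<F>) v / sesq w (cmat E - Qmat E \<E> \<F>) v"

definition rho_infinite ::
    "real ^ 'm ^ 'm \<Rightarrow> complex ^ 'n ^ 'm \<Rightarrow> complex ^ 'n ^ 'm
      \<Rightarrow> complex ^ 'm \<Rightarrow> complex ^ 'm \<Rightarrow> bool" where
  "rho_infinite E \<E> \<F> v w \<longleftrightarrow>
     sesq w (cmat E - Qmat E \<E> \<F>) v = 0 \<and> sesq w (Qmat E \<E> \<F>) v \<noteq> 0"

definition rho_abs ::
    "real ^ 'm ^ 'm \<Rightarrow> complex ^ 'n ^ 'm \<Rightarrow> complex ^ 'n ^ 'm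
      \<Rightarrow> complex ^ 'm \<Rightarrow> complex ^ 'm \<Rightarrow> ereal" where
  "rho_abs E \<E> \<F> v w =
     (if rho_infinite E \<E> \<F> v w then \<infinity> else ereal (cmod (rho E \<E> \<F> v w)))"

definition rho_inv ::
    "real ^ 'm ^ 'm \<Rightarrow> complex ^ 'n ^ 'm \<Rightarrow> complex ^ 'n ^ 'm
      \<Rightarrow> complex ^ 'm \<Rightarrow> complex ^ 'm \<Rightarrow> complex" where
  "rho_inv E \<E> \<F> v w =
     (if rho_infinite E \<E> \<F> v w then 0 else inverse (rho E \<E> \<F> v w))"

end

theory Submission
  imports Defs
begin

text \<open>
  The step from \<open>\<mu>\<close> to \<open>\<nu>\<close> is governed by the two-parameter pencil
  \<open>T(z, \<mu>) = z Q + \<mu> (E - Q) - A\<close>, which is \<open>\<mu> E - A\<close> on the diagonal \<open>z = \<mu>\<close>. Here the spectral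
  parameter has been split: \<open>Q\<close> carries the new value, the complement \<open>E - Q\<close> the old one. The
  matrix \<open>K(\<mu>) = \<mu> E - A + A Q + Q A\<close> is block diagonal with respect to \<open>Q\<close> and \<open>P = 1 - Q\<close>, its
  \<open>P\<close>-block being \<open>P (\<mu> E - A) P\<close>. When it is invertible, \<open>A\<^sub>r\<^sub>r + H(\<mu>)\<close> is therefore the Schur
  complement obtained by eliminating the range of \<open>P\<close>, and its eigenvalues are exactly the roots
  \<open>z\<close> of \<open>det T(z, \<mu>)\<close> (\<open>eigenvalue_reduced_iff\<close>).

  It remains to follow the root \<open>z\<close> near \<open>\<lambda>\<close> as \<open>\<mu>\<close> varies. The partial derivatives of
  \<open>det T\<close> at \<open>(\<lambda>, \<lambda>)\<close> with respect to \<open>z\<close> and \<open>\<mu>\<close> are \<open>C w\<^sup>\<dagger> Q v\<close> and \<open>C w\<^sup>\<dagger> (E - Q) v\<close> with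
  a common factor \<open>C\<close>; their sum is the derivative of \<open>det (t E - A)\<close> at the simple root
  \<open>\<lambda>\<close>, so \<open>C \<noteq> 0\<close>. An implicit function argument thus gives the slope \<open>-\<rho>\<^sup>-\<^sup>1\<close> of the root curve
  as soon as \<open>w\<^sup>\<dagger> Q v \<noteq> 0\<close>. The argument is made elementary by writing a nonzero multiple of
  \<open>det T\<close> exactly as \<open>a(z, \<mu>) (z - \<lambda>) + b(z, \<mu>) (\<mu> - \<lambda>)\<close> with continuous \<open>a\<close> and \<open>b\<close>
  (\<open>two_parameter_det_roots\<close>). Brouwer's theorem then provides a root close to \<open>\<lambda>\<close>, so
  the closest root is close as well, and the equation itself yields its first-order expansion
  (\<open>closest_root_expansion\<close>). If \<open>\<bar>\<rho>\<bar> > 1\<close>, the expansion makes every step a contraction towards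
  \<open>\<lambda>\<close> (\<open>linear_convergence\<close>).
\<close>

section \<open>A determinant near a singular matrix\<close>

text \<open>The cofactor of the entry \<open>(k, j)\<close>, with its sign. Row \<open>k\<close> is overwritten instead of being deleted,
  so that the index type stays the same.\<close>

definition row_minor :: "'m \<Rightarrow> 'm \<Rightarrow> 'a::comm_ring_1 ^ 'm ^ 'm \<Rightarrow> 'a" where
  "row_minor k j T = det (\<chi> i. if i = k then axis j 1 else T $ i)"

lemma det_replace_row_expansion:
  fixes T :: "'a::comm_ring_1 ^ 'm ^ 'm"
  shows "det (\<chi> i. if i = k then x else T $ i) = (\<Sum>j\<in>UNIV. x $ j * row_minor k j T)"
proof -
  have "det (\<chi> i. if i = k then x else T $ i)
      = det (\<chi> i. if i = k then (\<Sum>j\<in>UNIV. x $ j *s axis j 1) else T $ i)"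
    by (simp only: basis_expansion)
  also have "\<dots> = (\<Sum>j\<in>UNIV. det (\<chi> i. if i = k then x $ j *s axis j 1 else T $ i))"
    by (rule det_linear_row_sum[of UNIV k "\<lambda>i j. x $ j *s axis j 1" "\<lambda>i. T $ i"]) simp
  also have "\<dots> = (\<Sum>j\<in>UNIV. x $ j * row_minor k j T)"
    unfolding row_minor_def
    by (intro sum.cong refl det_row_mul[of k _ "\<lambda>i. axis _ 1" "\<lambda>i. T $ i"])
  finally show ?thesis .
qed

lemma det_row_combination:
  fixes T :: "'a::comm_ring_1 ^ 'm ^ 'm"
  shows "det (\<chi> i. if i = k then y v* T else T $ i) = y $ k * det T"
proof -
  have "y v* T = (\<Sum>i\<in>UNIV. y $ i *s T $ i)"
    by (simp add: vec_eq_iff vector_matrix_mult_def)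
  then have "det (\<chi> i. if i = k then y v* T else T $ i)
      = (\<Sum>j\<in>UNIV. det (\<chi> i. if i = k then y $ j *s T $ j else T $ i))"
    using det_linear_row_sum[of UNIV k "\<lambda>i j. y $ j *s T $ j" "\<lambda>i. T $ i"] by (simp only: finite)
  also have "\<dots> = (\<Sum>j\<in>UNIV. y $ j * det (\<chi> i. if i = k then T $ j else T $ i))"
    by (intro sum.cong refl det_row_mul[of k _ "\<lambda>i. T $ _" "\<lambda>i. T $ i"])
  also have "\<dots> = (\<Sum>j\<in>UNIV. if j = k then y $ k * det T else 0)"
  proof (intro sum.cong refl)
    fix j
    show "y $ j * det (\<chi> i. if i = k then T $ j else T $ i) = (if j = k then y $ k * det T else 0)"
    proof (cases "j = k")
      case True
      then have "(\<chi> i. if i = k then T $ j else T $ i) = T" by (simp add: vec_eq_iff)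
      with True show ?thesis by simp
    next
      case False
      then have "det (\<chi> i. if i = k then T $ j else T $ i) = 0"
        by (intro det_identical_rows[of j k]) (auto simp: row_def)
      with False show ?thesis by simp
    qed
  qed
  finally show ?thesis by simp
qed

text \<open>Replacing row \<open>k\<close> of \<open>T + D\<close> by the combination of its rows with coefficients \<open>y\<close> multiplies the
  determinant by \<open>y $ k\<close>. As \<open>y\<close> annihilates \<open>T\<close>, the new row is \<open>y v* D\<close>, which isolates one
  factor that is linear in \<open>D\<close>.\<close>

lemma det_near_left_kernel:
  fixes T D :: "'a::comm_ring_1 ^ 'm ^ 'm"
  assumes "y v* T = 0"
  shows "y $ k * det (T + D) = (\<Sum>j\<in>UNIV. (y v* D) $ j * row_minor k j (T + D))"
proof -
  have "y $ k * det (T + D) = det (\<chi> i. if i = k then y v* (T + D) else (T + D) $ i)"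
    by (rule det_row_combination[symmetric])
  also have "y v* (T + D) = y v* D"
    using assms by (simp add: vector_matrix_mult_add_rdistrib)
  finally show ?thesis
    by (simp only: det_replace_row_expansion)
qed

lemma det_eq_0_iff_kernel:
  fixes M :: "'a::field ^ 'm ^ 'm"
  shows "det M = 0 \<longleftrightarrow> (\<exists>x. x \<noteq> 0 \<and> M *v x = 0)"
proof -
  have "invertible M \<longleftrightarrow> (\<forall>x. M *v x = 0 \<longrightarrow> x = 0)"
    by (simp only: invertible_left_inverse matrix_left_invertible_ker)
  then show ?thesis using invertible_det_nz[of M] by blast
qed

text \<open>The cofactors of a row are the coefficients of the linear form that sends \<open>x\<close> to the determinant
  with \<open>x\<close> in that row. If \<open>x\<close> is orthogonal to \<open>v\<close>, the matrix with that row still annihilates \<open>v\<close>,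
  so this form vanishes on the orthogonal complement of \<open>v\<close> and must be a multiple of \<open>v\<close>.\<close>

lemma row_minor_proportional_kernel:
  fixes T :: "'a::field ^ 'm ^ 'm"
  assumes ker: "T *v v = 0" and p: "v $ p \<noteq> 0"
  shows "row_minor k j T = row_minor k p T / v $ p * v $ j"
proof -
  \<comment> \<open>The vector supported on \<open>j\<close> and \<open>p\<close> that is orthogonal to \<open>v\<close>.\<close>
  define x where "x = v $ p *s axis j 1 - v $ j *s axis p (1 :: 'a)"
  have pair: "(\<Sum>i\<in>UNIV. x $ i * f i) = v $ p * f j - v $ j * f p" for f
  proof -
    have "x $ i * f i = (if i = j then v $ p * f i else 0) - (if i = p then v $ j * f i else 0)" for i
      by (auto simp: x_def axis_def left_diff_distrib)
    then show ?thesis by (simp only: sum_subtractf) simp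
  qed
  let ?M = "\<chi> i. if i = k then x else T $ i"
  have "(?M *v v) $ i = 0" for i
  proof (cases "i = k")
    case True
    then show ?thesis
      using pair[of "\<lambda>i. v $ i"] by (simp add: matrix_vector_mult_def)
  next
    case False
    then have "(?M *v v) $ i = (T *v v) $ i"
      by (simp add: matrix_vector_mult_def)
    then show ?thesis using ker by simp
  qed
  then have "?M *v v = 0" by (simp add: vec_eq_iff)
  moreover have "v \<noteq> 0" using p by auto
  ultimately have "det ?M = 0"
    using det_eq_0_iff_kernel by blast
  then have "v $ p * row_minor k j T - v $ j * row_minor k p T = 0"
    by (simp only: det_replace_row_expansion pair)
  with p show ?thesis by (simp add: field_simps)
qed

lemma continuous_on_det:
  fixes M :: "'b::topological_space \<Rightarrow> 'a::real_normed_field ^ 'm ^ 'm"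
  assumes "\<And>i j. continuous_on S (\<lambda>x. M x $ i $ j)"
  shows "continuous_on S (\<lambda>x. det (M x))"
  unfolding det_def by (intro continuous_intros assms)

lemma continuous_on_row_minor:
  fixes M :: "'b::topological_space \<Rightarrow> 'a::real_normed_field ^ 'm ^ 'm"
  assumes "\<And>i j. continuous_on S (\<lambda>x. M x $ i $ j)"
  shows "continuous_on S (\<lambda>x. row_minor k j (M x))"
  unfolding row_minor_def
proof (rule continuous_on_det)
  show "continuous_on S (\<lambda>x. (\<chi> i. if i = k then axis j 1 else M x $ i) $ i $ l)" for i l
    by (cases "i = k") (simp_all add: assms)
qed

lemma mat_times_component: "(mat c ** M) $ i $ j = c * M $ i $ j"
  by (simp add: matrix_matrix_mult_def mat_def if_distrib if_distribR cong: if_cong)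

lemma vector_times_mat: "y v* (mat c ** M) = c *s (y v* M)"
  for M :: "'a::comm_ring_1 ^ 'n ^ 'm"
  by (simp add: vec_eq_iff vector_matrix_mult_def mat_times_component sum_distrib_left algebra_simps)

lemma bilinear_form_assoc:
  fixes M :: "'a::comm_semiring_1 ^ 'n ^ 'm"
  shows "(\<Sum>j\<in>UNIV. (y v* M) $ j * v $ j) = (\<Sum>i\<in>UNIV. y $ i * (M *v v) $ i)"
  unfolding vector_matrix_mult_def matrix_vector_mult_def
  by (simp add: sum_distrib_left sum_distrib_right mult.assoc) (rule sum.swap)

text \<open>Expanding the determinant by means of the left kernel vector gives an exact linear equation for its
  zero set, with coefficients that are sums of cofactors and hence continuous. At \<open>(lam, lam)\<close> the
  cofactors are proportional to \<open>v\<close>, which turns the coefficients into the bilinear forms of \<open>Q\<close> and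
  \<open>R\<close>. The common factor \<open>C\<close> cannot vanish, since otherwise the zero along the diagonal
  \<open>z = \<mu>\<close> would be multiple; this replaces an argument about the rank of \<open>T\<close>.\<close>

lemma two_parameter_det_roots:
  fixes T Q R :: "complex ^ 'm ^ 'm" and lam :: complex and N :: "complex \<Rightarrow> complex \<Rightarrow> complex ^ 'm ^ 'm"
  defines "N \<equiv> \<lambda>z \<mu>. T + (mat (z - lam) ** Q + mat (\<mu> - lam) ** R)"
  assumes left: "y \<noteq> 0" "y v* T = 0"
    and right: "v \<noteq> 0" "T *v v = 0"
    and simple: "\<And>t. det (N t t) = (t - lam) * q t" "isCont q lam" "q lam \<noteq> 0"
  obtains a b C where
    "continuous_on UNIV (\<lambda>(z, \<mu>). a z \<mu>)" "continuous_on UNIV (\<lambda>(z, \<mu>). b z \<mu>)"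
    "\<And>z \<mu>. det (N z \<mu>) = 0 \<longleftrightarrow> a z \<mu> * (z - lam) + b z \<mu> * (\<mu> - lam) = 0"
    "C \<noteq> 0"
    "a lam lam = C * (\<Sum>i\<in>UNIV. y $ i * (Q *v v) $ i)"
    "b lam lam = C * (\<Sum>i\<in>UNIV. y $ i * (R *v v) $ i)"
proof -
  obtain k where k: "y $ k \<noteq> 0" using left(1) by (auto simp: vec_eq_iff)
  obtain p where p: "v $ p \<noteq> 0" using right(1) by (auto simp: vec_eq_iff)
  define form where "form M z \<mu> = (\<Sum>j\<in>UNIV. (y v* M) $ j * row_minor k j (N z \<mu>))"
    for M z \<mu>
  define C where "C = row_minor k p T / v $ p"
  have N_lam: "N lam lam = T"
    by (simp add: N_def vec_eq_iff mat_times_component)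
  have minor_cont: "continuous_on UNIV (\<lambda>p. row_minor k j (N (fst p) (snd p)))" for j
    by (rule continuous_on_row_minor) (simp add: N_def mat_times_component, intro continuous_intros)
  have form_cont: "continuous_on UNIV (\<lambda>(z, \<mu>). form M z \<mu>)" for M
    unfolding form_def case_prod_beta by (intro continuous_intros minor_cont)
  have form_lam: "form M lam lam = C * (\<Sum>i\<in>UNIV. y $ i * (M *v v) $ i)" for M
  proof -
    have "form M lam lam = (\<Sum>j\<in>UNIV. (y v* M) $ j * (C * v $ j))"
      unfolding form_def N_lam C_def
      by (intro sum.cong refl arg_cong2[where f = "(*)"] row_minor_proportional_kernel right(2) p)
    also have "\<dots> = C * (\<Sum>j\<in>UNIV. (y v* M) $ j * v $ j)"
      by (simp add: sum_distrib_left mult_ac)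
    finally show ?thesis by (simp only: bilinear_form_assoc)
  qed
  have expansion: "y $ k * det (N z \<mu>) = form Q z \<mu> * (z - lam) + form R z \<mu> * (\<mu> - lam)" for z \<mu>
  proof -
    have "y $ k * det (N z \<mu>) = (\<Sum>j\<in>UNIV.
        (y v* (mat (z - lam) ** Q + mat (\<mu> - lam) ** R)) $ j * row_minor k j (N z \<mu>))"
      unfolding N_def by (rule det_near_left_kernel[OF left(2)])
    also have "\<dots> = (\<Sum>j\<in>UNIV. (y v* Q) $ j * row_minor k j (N z \<mu>) * (z - lam)
        + (y v* R) $ j * row_minor k j (N z \<mu>) * (\<mu> - lam))"
      by (intro sum.cong refl)
         (simp add: vector_matrix_mult_add_rdistrib vector_times_mat algebra_simps)
    finally show ?thesis
      by (simp only: form_def sum.distrib sum_distrib_right)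
  qed
  have diagonal: "((\<lambda>t. form M t t) \<longlongrightarrow> form M lam lam) (at lam)" for M
  proof -
    have "isCont (\<lambda>(z, \<mu>). form M z \<mu>) (lam, lam)"
      using form_cont by (simp add: continuous_on_eq_continuous_at)
    moreover have "isCont (\<lambda>t. (t, t)) lam"
      by (intro continuous_intros)
    ultimately have "isCont (\<lambda>t. form M t t) lam"
      using isCont_o2[where f = "\<lambda>t. (t, t)" and g = "\<lambda>(z, \<mu>). form M z \<mu>" and a = lam]
      by simp
    then show ?thesis by (simp add: isCont_def)
  qed
  have "C \<noteq> 0"
  proof
    assume "C = 0"
    then have "((\<lambda>t. form Q t t + form R t t) \<longlongrightarrow> 0) (at lam)"
      using tendsto_add[OF diagonal[of Q] diagonal[of R]] by (simp add: form_lam)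
    moreover have "form Q t t + form R t t = y $ k * q t" if "t \<noteq> lam" for t
    proof -
      have "(form Q t t + form R t t) * (t - lam) = y $ k * q t * (t - lam)"
        using expansion[of t t] by (simp add: simple(1) algebra_simps)
      with that show ?thesis by simp
    qed
    ultimately have "((\<lambda>t. y $ k * q t) \<longlongrightarrow> 0) (at lam)"
      using LIM_equal[of lam "\<lambda>t. form Q t t + form R t t" "\<lambda>t. y $ k * q t" 0] by simp
    moreover have "((\<lambda>t. y $ k * q t) \<longlongrightarrow> y $ k * q lam) (at lam)"
      using simple(2) by (intro tendsto_intros) (simp add: isCont_def)
    ultimately have "y $ k * q lam = 0"
      by (rule LIM_unique[symmetric])
    with k simple(3) show False by simp
  qed
  moreover have "det (N z \<mu>) = 0 \<longleftrightarrow> form Q z \<mu> * (z - lam) + form R z \<mu> * (\<mu> - lam) = 0" for z \<mu>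
    using k by (simp flip: expansion)
  ultimately show thesis
    using form_cont form_lam that by blast
qed

section \<open>The reduced eigenvalue problem\<close>

lemma matrix_inv_inverse:
  assumes "invertible M"
  shows "M ** matrix_inv M = mat 1" "matrix_inv M ** M = mat 1"
  using someI_ex[OF assms[unfolded invertible_def]] unfolding matrix_inv_def by auto

lemma mat_times_vector: "mat c *v x = c *s x"
  for x :: "'a::semiring_1 ^ 'm"
  by (simp add: vec_eq_iff matrix_vector_mult_def mat_def if_distrib if_distribR cong: if_cong)

text \<open>The matrix \<open>G\<close> plays the role of \<open>\<F>\<^sup>\<dagger>\<close>. The columns of \<open>eps\<close> may leave the range of \<open>E\<close>, and
  the rows of \<open>G\<close> its row space: their parts outside cancel between the two summands of
  \<open>reduced\<close>.\<close>

locale oblique_reduction =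
  fixes E A :: "'a::field ^ 'm ^ 'm"
    and eps :: "'a ^ 'n ^ 'm" and G :: "'a ^ 'm ^ 'n"
  assumes idem: "E ** E = E"
    and normal: "G ** E ** eps = mat 1"
begin

definition Q :: "'a ^ 'm ^ 'm" where
  "Q = E ** eps ** G ** E"

definition K :: "'a \<Rightarrow> 'a ^ 'm ^ 'm" where
  "K \<mu> = mat \<mu> ** E - A + (A ** Q + Q ** A)"

definition reduced :: "'a \<Rightarrow> 'a ^ 'n ^ 'n" where
  "reduced \<mu> = G ** A ** eps
     + G ** A ** (mat 1 - Q) ** matrix_inv (K \<mu>) ** (mat 1 - Q) ** A ** eps"

definition split_pencil :: "'a \<Rightarrow> 'a \<Rightarrow> 'a ^ 'm ^ 'm" where
  "split_pencil z \<mu> = mat z ** Q + mat \<mu> ** (E - Q) - A"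

text \<open>The vector whose \<open>Q\<close>-component is prescribed by \<open>\<alpha>\<close> and whose other component is found by
  eliminating the range of \<open>1 - Q\<close>.\<close>

definition lift :: "'a \<Rightarrow> 'a ^ 'n \<Rightarrow> 'a ^ 'm" where
  "lift \<mu> \<alpha> = eps *v \<alpha> + matrix_inv (K \<mu>) *v ((mat 1 - Q) *v (A *v (eps *v \<alpha>)))"

lemma E_E [simp]: "E *v (E *v x) = E *v x"
  by (simp add: matrix_vector_mul_assoc idem)

lemma G_E_eps [simp]: "G *v (E *v (eps *v \<alpha>)) = \<alpha>"
  by (simp add: matrix_vector_mul_assoc matrix_mul_assoc normal)

lemmas vec_simps = matrix_vector_right_distrib matrix_vector_mult_diff_distrib
  matrix_vector_mult_add_rdistrib matrix_vector_mult_diff_rdistrib vector_scalar_commute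
  mat_times_vector

lemma Q_apply: "Q *v x = E *v (eps *v (G *v (E *v x)))"
  by (simp add: Q_def flip: matrix_vector_mul_assoc)

lemma K_apply: "K \<mu> *v x = \<mu> *s (E *v x) - A *v x + (A *v (Q *v x) + Q *v (A *v x))"
  by (simp add: K_def vec_simps flip: matrix_vector_mul_assoc)

lemma split_pencil_apply: "split_pencil z \<mu> *v x = z *s (Q *v x) + \<mu> *s (E *v x - Q *v x) - A *v x"
  by (simp add: split_pencil_def vec_simps flip: matrix_vector_mul_assoc)

lemma E_Q [simp]: "E *v (Q *v x) = Q *v x" and Q_E [simp]: "Q *v (E *v x) = Q *v x"
  and Q_Q [simp]: "Q *v (Q *v x) = Q *v x" and Q_eps [simp]: "Q *v (eps *v \<alpha>) = E *v (eps *v \<alpha>)"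
  by (simp_all add: Q_apply)

lemma K_commutes_Q: "K \<mu> *v (Q *v x) = Q *v (K \<mu> *v x)"
  by (simp add: K_apply vec_simps)

lemma reduced_apply:
  "reduced \<mu> *v \<alpha> = G *v (A *v (eps *v \<alpha>)) + G *v (A *v ((mat 1 - Q) *v (matrix_inv (K \<mu>) *v
      ((mat 1 - Q) *v (A *v (eps *v \<alpha>))))))"
  by (simp add: reduced_def matrix_vector_mult_add_rdistrib matrix_vector_mul_assoc matrix_mul_assoc)

context
  fixes \<mu> :: 'a
  assumes K_invertible: "invertible (K \<mu>)"
begin

lemma K_matrix_inv: "K \<mu> *v (matrix_inv (K \<mu>) *v x) = x"
  by (simp add: matrix_vector_mul_assoc matrix_inv_inverse K_invertible)

lemma K_eq_0:
  assumes "K \<mu> *v x = 0"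
  shows "x = 0"
proof -
  have "x = matrix_inv (K \<mu>) *v (K \<mu> *v x)"
    by (simp add: matrix_vector_mul_assoc matrix_inv_inverse K_invertible)
  then show ?thesis by (simp only: assms matrix_vector_mult_0_right)
qed

text \<open>The block elimination: on lifted vectors the \<open>1 - Q\<close>-component of the split pencil vanishes, and
  its \<open>Q\<close>-component is the reduced problem.\<close>

lemma split_pencil_lift: "split_pencil z \<mu> *v lift \<mu> \<alpha> = E *v (eps *v (z *s \<alpha> - reduced \<mu> *v \<alpha>))"
  and Q_lift: "Q *v lift \<mu> \<alpha> = E *v (eps *v \<alpha>)"
proof -
  define u where "u = matrix_inv (K \<mu>) *v ((mat 1 - Q) *v (A *v (eps *v \<alpha>)))"
  define x where "x = lift \<mu> \<alpha>"
  have x: "x = eps *v \<alpha> + u" by (simp add: x_def u_def lift_def)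
  have Ku: "K \<mu> *v u = A *v (eps *v \<alpha>) - Q *v (A *v (eps *v \<alpha>))"
    by (simp only: u_def K_matrix_inv) (simp add: vec_simps)
  \<comment> \<open>As \<open>K\<close> commutes with \<open>Q\<close>, its inverse preserves the kernel of \<open>Q\<close>.\<close>
  have "K \<mu> *v (Q *v u) = 0"
    by (simp only: K_commutes_Q Ku) (simp add: vec_simps)
  then have Qu: "Q *v u = 0" by (rule K_eq_0)
  have Ax: "A *v x = Q *v (A *v x) + \<mu> *s (E *v u)"
    using Ku by (simp add: K_apply x Qu vec_simps algebra_simps)
  have "E *v (A *v x) = A *v x"
    by (subst (1 2) Ax) (simp add: vec_simps)
  then have QAx: "Q *v (A *v x) = E *v (eps *v (G *v (A *v x)))"
    by (simp add: Q_apply)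
  have Sx: "reduced \<mu> *v \<alpha> = G *v (A *v x)"
    by (simp only: reduced_apply u_def[symmetric]) (simp add: vec_simps Qu x)
  show Qx: "Q *v lift \<mu> \<alpha> = E *v (eps *v \<alpha>)"
    unfolding x_def[symmetric] by (simp add: x Qu vec_simps)
  have "split_pencil z \<mu> *v x = z *s (E *v (eps *v \<alpha>)) + \<mu> *s (E *v u) - A *v x"
    by (simp add: split_pencil_apply x vec_simps Qu)
  also have "\<dots> = z *s (E *v (eps *v \<alpha>)) - Q *v (A *v x)"
    by (subst Ax) simp
  finally show "split_pencil z \<mu> *v lift \<mu> \<alpha> = E *v (eps *v (z *s \<alpha> - reduced \<mu> *v \<alpha>))"
    unfolding x_def[symmetric] by (simp add: QAx Sx vec_simps)
qed

lemma G_E_lift [simp]: "G *v (E *v lift \<mu> \<alpha>) = \<alpha>"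
proof -
  have "G *v (E *v (Q *v lift \<mu> \<alpha>)) = \<alpha>"
    by (simp add: Q_lift)
  then show ?thesis by (simp add: Q_apply)
qed

text \<open>Lifting carries eigenvectors of the reduced matrix to kernel vectors of the split pencil. All
  kernel vectors \<open>x\<close> arise in this way. Let \<open>d\<close> be the difference of \<open>x\<close> and the lift of its
  coordinate vector \<open>G E x\<close>. Then \<open>Q d = 0\<close>, so that \<open>K d\<close> is the \<open>1 - Q\<close>-component of the split
  pencil applied to \<open>d\<close>. This component is zero for \<open>x\<close> and for every lift, hence \<open>d = 0\<close>.\<close>

lemma eigenvalue_reduced_iff:
  "(\<exists>\<alpha>. \<alpha> \<noteq> 0 \<and> reduced \<mu> *v \<alpha> = z *s \<alpha>) \<longleftrightarrow> det (split_pencil z \<mu>) = 0"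
proof -
  have kernel_T: "\<exists>x. x \<noteq> 0 \<and> split_pencil z \<mu> *v x = 0" if "\<alpha> \<noteq> 0" "reduced \<mu> *v \<alpha> = z *s \<alpha>" for \<alpha>
  proof (intro exI conjI)
    show "lift \<mu> \<alpha> \<noteq> 0"
    proof
      assume "lift \<mu> \<alpha> = 0"
      then have "G *v (E *v 0) = \<alpha>" by (metis G_E_lift)
      with that(1) show False by simp
    qed
    show "split_pencil z \<mu> *v lift \<mu> \<alpha> = 0" by (simp add: split_pencil_lift that(2))
  qed
  have eigenvector_S: "\<exists>\<alpha>. \<alpha> \<noteq> 0 \<and> reduced \<mu> *v \<alpha> = z *s \<alpha>" if "x \<noteq> 0" and Tx: "split_pencil z \<mu> *v x = 0" for x
  proof -
    define \<alpha> where "\<alpha> = G *v (E *v x)"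
    define d where "d = x - lift \<mu> \<alpha>"
    have GEd: "G *v (E *v d) = 0" by (simp add: d_def \<alpha>_def vec_simps)
    then have Qd: "Q *v d = 0" by (simp add: Q_apply)
    define b where "b = z *s \<alpha> - reduced \<mu> *v \<alpha>"
    have Td: "split_pencil z \<mu> *v d = - (E *v (eps *v b))"
      by (simp add: d_def vec_simps Tx split_pencil_lift b_def)
    have "A *v d = \<mu> *s (E *v d) + E *v (eps *v b)"
      using Td by (simp add: split_pencil_apply Qd algebra_simps)
    then have "K \<mu> *v d = 0"
      by (simp add: K_apply Qd vec_simps)
    then have "d = 0" by (rule K_eq_0)
    then have "E *v (eps *v b) = 0" using Td by simp
    then have "b = 0" using G_E_eps[of b] by (simp del: G_E_eps)
    moreover have "\<alpha> \<noteq> 0"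
    proof
      assume "\<alpha> = 0"
      then have "x = 0" using \<open>d = 0\<close> by (simp add: d_def lift_def)
      with \<open>x \<noteq> 0\<close> show False ..
    qed
    ultimately show ?thesis by (auto simp: b_def)
  qed
  show ?thesis
    unfolding det_eq_0_iff_kernel by (rule iffI; elim exE conjE) (fact kernel_T eigenvector_S)+
qed

end

end

section \<open>The closest root, and linear convergence\<close>

text \<open>Where \<open>a \<noteq> 0\<close>, roots are the fixed points of \<open>z \<mapsto> lam - b/a * (\<mu> - lam)\<close>. For \<open>\<mu>\<close> close to
  \<open>lam\<close> this map sends a small disc around \<open>lam\<close> into itself, so Brouwer's theorem yields a root in the disc. The
  closest root is then also in the disc, where \<open>b/a\<close> differs little from its value at the centre.\<close>

lemma closest_root_expansion:
  fixes a b :: "complex \<Rightarrow> complex \<Rightarrow> complex"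
  assumes cont: "continuous_on UNIV (\<lambda>(z, \<mu>). a z \<mu>)" "continuous_on UNIV (\<lambda>(z, \<mu>). b z \<mu>)"
    and nz: "a lam lam \<noteq> 0" and "c > 0"
  obtains \<eta> where "\<eta> > 0"
    "\<And>\<mu> \<nu>. cmod (\<mu> - lam) < \<eta> \<Longrightarrow>
       is_arg_min (\<lambda>z. cmod (z - lam)) (\<lambda>z. a z \<mu> * (z - lam) + b z \<mu> * (\<mu> - lam) = 0) \<nu> \<Longrightarrow>
       cmod (\<nu> - lam + b lam lam / a lam lam * (\<mu> - lam)) \<le> c * cmod (\<mu> - lam)"
proof -
  define g where "g = (\<lambda>(z, \<mu>). b z \<mu> / a z \<mu>)"
  define g0 where "g0 = b lam lam / a lam lam"
  have ab_cont: "isCont (\<lambda>p. a (fst p) (snd p)) p" "isCont (\<lambda>p. b (fst p) (snd p)) p" for p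
    using cont by (auto simp: continuous_on_eq_continuous_at case_prod_beta simp del: split_paired_All)
  have g_cont: "isCont g p" if "a (fst p) (snd p) \<noteq> 0" for p
    unfolding g_def case_prod_beta by (intro isCont_divide ab_cont that)
  have "\<forall>\<^sub>F p in nhds (lam, lam). a (fst p) (snd p) \<noteq> 0"
    using tendsto_at_iff_tendsto_nhds[THEN iffD1, OF ab_cont(1)[of "(lam, lam)", unfolded isCont_def]] nz
    by (intro tendsto_imp_eventually_ne[of _ "a lam lam"]) simp_all
  moreover have "\<forall>\<^sub>F p in nhds (lam, lam). dist (g p) g0 < c"
  proof -
    have "(g \<longlongrightarrow> g (lam, lam)) (nhds (lam, lam))"
      using g_cont[of "(lam, lam)"] nz by (simp add: isCont_def tendsto_at_iff_tendsto_nhds)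
    then show ?thesis
      using \<open>c > 0\<close> tendstoD[of g "g (lam,lam)"] by (simp add: g_def g0_def)
  qed
  ultimately have "\<forall>\<^sub>F p in nhds (lam, lam). a (fst p) (snd p) \<noteq> 0 \<and> dist (g p) g0 < c"
    by (rule eventually_conj)
  then obtain d where "d > 0" and d: "\<And>p. dist p (lam, lam) < d \<Longrightarrow> a (fst p) (snd p) \<noteq> 0 \<and> dist (g p) g0 < c"
    unfolding eventually_nhds_metric by blast
  \<comment> \<open>If \<open>z\<close> and \<open>\<mu>\<close> are both within \<open>r\<close> of \<open>lam\<close>, the pair is within \<open>2 r < d\<close> of \<open>(lam, lam)\<close>.\<close>
  define r where "r = d / 3"
  have "r > 0" using \<open>d > 0\<close> by (simp add: r_def)
  have near: "a z \<mu> \<noteq> 0" "dist (g (z, \<mu>)) g0 < c" if "cmod (z - lam) \<le> r" "cmod (\<mu> - lam) \<le> r" for z \<mu>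
  proof -
    have "dist (z, \<mu>) (lam, lam) \<le> dist z lam + dist \<mu> lam"
      unfolding dist_Pair_Pair by (rule sqrt_sum_squares_le_sum) auto
    also have "\<dots> < d" using that \<open>d > 0\<close> by (simp add: dist_norm r_def)
    finally show "a z \<mu> \<noteq> 0" "dist (g (z, \<mu>)) g0 < c" using d by fastforce+
  qed
  have root_iff: "a z \<mu> * (z - lam) + b z \<mu> * (\<mu> - lam) = 0 \<longleftrightarrow> lam - g (z, \<mu>) * (\<mu> - lam) = z"
    if "a z \<mu> \<noteq> 0" for z \<mu>
    using that by (auto simp: g_def field_simps)
  \<comment> \<open>On the disc \<open>g\<close> is bounded by \<open>cmod g0 + c\<close>, so the second bound makes the map a self-map.\<close>
  define \<eta> where "\<eta> = min r (r / (cmod g0 + c))"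
  have pos: "cmod g0 + c > 0" using \<open>c > 0\<close> by (simp add: add_nonneg_pos)
  show thesis
  proof
    show "\<eta> > 0" using \<open>r > 0\<close> pos by (simp add: \<eta>_def)
    fix \<mu> \<nu>
    assume \<mu>: "cmod (\<mu> - lam) < \<eta>"
      and \<nu>: "is_arg_min (\<lambda>z. cmod (z - lam)) (\<lambda>z. a z \<mu> * (z - lam) + b z \<mu> * (\<mu> - lam) = 0) \<nu>"
    have \<mu>r: "cmod (\<mu> - lam) \<le> r" using \<mu> by (simp add: \<eta>_def)
    have bound: "cmod (g (z, \<mu>) * (\<mu> - lam)) \<le> r" if "cmod (z - lam) \<le> r" for z
    proof -
      have "cmod (g (z, \<mu>)) \<le> cmod g0 + c"
        using near(2)[OF that \<mu>r] norm_triangle_sub[of "g (z, \<mu>)" g0] by (simp add: dist_norm)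
      then have "cmod (g (z, \<mu>) * (\<mu> - lam)) \<le> (cmod g0 + c) * (r / (cmod g0 + c))"
        unfolding norm_mult using \<mu> pos by (intro mult_mono) (auto simp: \<eta>_def)
      then show ?thesis using pos by simp
    qed
    obtain z where z: "z \<in> cball lam r" "lam - g (z, \<mu>) * (\<mu> - lam) = z"
    proof (rule brouwer_ball[OF \<open>r > 0\<close>, of lam "\<lambda>z. lam - g (z, \<mu>) * (\<mu> - lam)"])
      show "continuous_on (cball lam r) (\<lambda>z. lam - g (z, \<mu>) * (\<mu> - lam))"
      proof (intro continuous_intros continuous_at_imp_continuous_on ballI)
        fix z assume "z \<in> cball lam r"
        then have "a z \<mu> \<noteq> 0" using near(1) \<mu>r by (simp add: dist_norm norm_minus_commute)
        then have "continuous (at (z, \<mu>)) g" by (intro g_cont) simp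
        then show "isCont (\<lambda>z. g (z, \<mu>)) z"
          by (intro isCont_o2[of z "\<lambda>z. (z, \<mu>)" g] continuous_intros)
      qed
      show "(\<lambda>z. lam - g (z, \<mu>) * (\<mu> - lam)) \<in> cball lam r \<rightarrow> cball lam r"
        using bound by (auto simp: dist_norm norm_minus_commute)
    qed auto
    have zr: "cmod (z - lam) \<le> r" using z(1) by (simp add: dist_norm norm_minus_commute)
    then have "a z \<mu> * (z - lam) + b z \<mu> * (\<mu> - lam) = 0"
      using z(2) root_iff near(1) \<mu>r by blast
    then have "cmod (\<nu> - lam) \<le> cmod (z - lam)"
      using \<nu> by (auto simp: is_arg_min_def not_less)
    then have \<nu>r: "cmod (\<nu> - lam) \<le> r" using zr by simp
    have "lam - g (\<nu>, \<mu>) * (\<mu> - lam) = \<nu>"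
      using \<nu> root_iff near(1)[OF \<nu>r \<mu>r] by (simp add: is_arg_min_def)
    then have "\<nu> - lam + g0 * (\<mu> - lam) = (g0 - g (\<nu>, \<mu>)) * (\<mu> - lam)"
      by (simp add: algebra_simps)
    then have "cmod (\<nu> - lam + g0 * (\<mu> - lam)) = dist (g (\<nu>, \<mu>)) g0 * cmod (\<mu> - lam)"
      by (simp add: norm_mult dist_norm norm_minus_commute)
    also have "\<dots> \<le> c * cmod (\<mu> - lam)"
      using near(2)[OF \<nu>r \<mu>r] by (intro mult_right_mono) auto
    finally show "cmod (\<nu> - lam + b lam lam / a lam lam * (\<mu> - lam)) \<le> c * cmod (\<mu> - lam)"
      by (simp add: g0_def)
  qed
qed

text \<open>The expansion with error constant \<open>c = (1 - norm \<kappa>) / 2\<close> contracts the distance to \<open>lam\<close> by a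
  factor \<open>q < 1\<close>, so the sequence never leaves the region where the expansion applies and converges
  geometrically. Convergence in turn makes the expansion available for arbitrarily small \<open>c\<close> along
  the tail of the sequence, which is the \<open>o\<close> estimate.\<close>

lemma linear_convergence:
  fixes lam \<kappa> :: "'a::real_normed_field" and step :: "'a \<Rightarrow> 'a \<Rightarrow> bool"
  assumes \<kappa>: "norm \<kappa> < 1"
    and expansion: "\<And>c. c > 0 \<Longrightarrow> \<exists>\<eta>>0. \<forall>\<mu> \<nu>. norm (\<mu> - lam) < \<eta> \<and> step \<mu> \<nu> \<longrightarrow>
       norm (\<nu> - lam + \<kappa> * (\<mu> - lam)) \<le> c * norm (\<mu> - lam)"
  obtains \<delta> where "\<delta> > 0"
    "\<And>l. (\<And>j. step (l j) (l (Suc j))) \<Longrightarrow> norm (l 0 - lam) < \<delta> \<Longrightarrow>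
       (\<forall>j. norm (l j - lam) \<le> norm (l 0 - lam)) \<and> l \<longlonglongrightarrow> lam \<and>
       (\<lambda>j. (l (Suc j) - lam) + \<kappa> * (l j - lam)) \<in> o(\<lambda>j. l j - lam)"
proof -
  define q where "q = (1 + norm \<kappa>) / 2"
  have q: "0 < q" "q < 1" "norm \<kappa> + (1 - norm \<kappa>) / 2 = q"
    using \<kappa> by (auto simp: q_def field_simps add_pos_nonneg)
  obtain \<delta> where "\<delta> > 0" and \<delta>: "\<And>\<mu> \<nu>. norm (\<mu> - lam) < \<delta> \<Longrightarrow> step \<mu> \<nu> \<Longrightarrow>
       norm (\<nu> - lam + \<kappa> * (\<mu> - lam)) \<le> (1 - norm \<kappa>) / 2 * norm (\<mu> - lam)"
    using expansion[of "(1 - norm \<kappa>) / 2"] \<kappa> by auto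
  show thesis
  proof
    show "\<delta> > 0" by fact
    fix l assume step: "\<And>j. step (l j) (l (Suc j))" and l0: "norm (l 0 - lam) < \<delta>"
    have contract: "norm (l (Suc j) - lam) \<le> q * norm (l j - lam)" if "norm (l j - lam) < \<delta>" for j
    proof -
      have "norm (l (Suc j) - lam) \<le> norm (l (Suc j) - lam + \<kappa> * (l j - lam)) + norm (\<kappa> * (l j - lam))"
        by (metis add_diff_cancel_right' norm_triangle_ineq4)
      also have "\<dots> \<le> (1 - norm \<kappa>) / 2 * norm (l j - lam) + norm \<kappa> * norm (l j - lam)"
        using \<delta>[OF that step] by (simp add: norm_mult)
      also have "\<dots> = q * norm (l j - lam)"
        unfolding q(3)[symmetric] by (simp add: algebra_simps)
      finally show ?thesis .
    qed
    have geo: "norm (l j - lam) \<le> q ^ j * norm (l 0 - lam)" for j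
    proof (induction j)
      case (Suc j)
      have "q ^ j * norm (l 0 - lam) \<le> norm (l 0 - lam)"
        using q by (intro mult_left_le_one_le) (auto simp: power_le_one)
      then have "norm (l j - lam) < \<delta>" using Suc l0 by linarith
      from contract[OF this] have "norm (l (Suc j) - lam) \<le> q * norm (l j - lam)" .
      also have "\<dots> \<le> q * (q ^ j * norm (l 0 - lam))"
        using Suc q by (intro mult_left_mono) auto
      finally show ?case by (simp add: mult.assoc)
    qed simp
    have mono: "norm (l j - lam) \<le> norm (l 0 - lam)" for j
    proof -
      have "q ^ j * norm (l 0 - lam) \<le> norm (l 0 - lam)"
        using q by (intro mult_left_le_one_le) (auto simp: power_le_one)
      then show ?thesis using geo[of j] by linarith
    qed
    have "(\<lambda>j. q ^ j * norm (l 0 - lam)) \<longlonglongrightarrow> 0"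
      using q by (intro tendsto_mult_left_zero LIMSEQ_realpow_zero) auto
    then have lim0: "(\<lambda>j. l j - lam) \<longlonglongrightarrow> 0"
      by (rule Lim_null_comparison[rotated]) (use geo in simp)
    then have "l \<longlonglongrightarrow> lam" by (rule LIM_zero_cancel)
    moreover have "(\<lambda>j. (l (Suc j) - lam) + \<kappa> * (l j - lam)) \<in> o(\<lambda>j. l j - lam)"
    proof (rule landau_o.smallI)
      fix c :: real assume "c > 0"
      then obtain \<eta> where "\<eta> > 0" and \<eta>: "\<forall>\<mu> \<nu>. norm (\<mu> - lam) < \<eta> \<and> step \<mu> \<nu> \<longrightarrow>
        norm (\<nu> - lam + \<kappa> * (\<mu> - lam)) \<le> c * norm (\<mu> - lam)"
        using expansion by blast
      have "\<forall>\<^sub>F j in sequentially. norm (l j - lam) < \<eta>"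
        using tendstoD[OF lim0 \<open>\<eta> > 0\<close>] by simp
      then show "\<forall>\<^sub>F j in sequentially. norm ((l (Suc j) - lam) + \<kappa> * (l j - lam)) \<le> c * norm (l j - lam)"
        by eventually_elim (use \<eta> step in blast)
    qed
    ultimately show "(\<forall>j. norm (l j - lam) \<le> norm (l 0 - lam)) \<and> l \<longlonglongrightarrow> lam \<and>
       (\<lambda>j. (l (Suc j) - lam) + \<kappa> * (l j - lam)) \<in> o(\<lambda>j. l j - lam)"
      using mono by blast
  qed
qed

section \<open>Convergence of the iteration\<close>

lemma cmat_times: "cmat (M ** N) = cmat M ** cmat N"
  by (simp add: vec_eq_iff matrix_matrix_mult_def map_matrix_def)

lemma poly_det: "poly (det M) x = det (\<chi> i j. poly (M $ i $ j) x)"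
  for M :: "'a::comm_ring_1 poly ^ 'm ^ 'm"
  by (simp add: det_def poly_sum poly_prod)

lemma poly_pencil_poly: "poly (pencil_poly E A) t = det (pencil E A t)"
  unfolding pencil_poly_def poly_det pencil_def
  by (rule arg_cong[where f = det]) (simp add: vec_eq_iff mat_times_component)

text \<open>Regularity excludes the zero polynomial, whose \<open>order\<close> carries no information.\<close>

lemma simple_pencil_eigenvalue_factor:
  assumes "regular_pencil E A" "simple_pencil_eigenvalue E A lam"
  obtains q where "\<And>t. det (pencil E A t) = (t - lam) * poly q t" "poly q lam \<noteq> 0"
proof -
  have "pencil_poly E A \<noteq> 0"
  proof
    assume "pencil_poly E A = 0"
    then have "{\<mu>. \<not> invertible (pencil E A \<mu>)} = UNIV"
      using poly_pencil_poly[of E A] by (auto simp: invertible_det_nz)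
    with assms(1) show False
      by (simp add: regular_pencil_def infinite_UNIV_char_0)
  qed
  then obtain q where q: "pencil_poly E A = [:- lam, 1:] ^ order lam (pencil_poly E A) * q"
    "\<not> [:- lam, 1:] dvd q"
    using order_decomp by blast
  have "order lam (pencil_poly E A) = 1"
    using assms(2) by (simp add: simple_pencil_eigenvalue_def)
  with q(1) have factor: "pencil_poly E A = [:- lam, 1:] * q" by simp
  have "det (pencil E A t) = (t - lam) * poly q t" for t
    unfolding poly_pencil_poly[symmetric] factor by (simp add: algebra_simps)
  moreover have "poly q lam \<noteq> 0" using q(2) by (simp add: poly_eq_0_iff_dvd)
  ultimately show thesis by (rule that)
qed

lemma invertible_Kmat_near:
  assumes "invertible (Kmat A E \<E> \<F> lam)"
  obtains d where "d > 0" "\<And>\<mu>. cmod (\<mu> - lam) < d \<Longrightarrow> invertible (Kmat A E \<E> \<F> \<mu>)"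
proof -
  have "continuous_on UNIV (\<lambda>\<mu>. det (Kmat A E \<E> \<F> \<mu>))"
    unfolding Kmat_def
    by (intro continuous_on_det) (simp add: mat_times_component, intro continuous_intros)
  then have "isCont (\<lambda>\<mu>. det (Kmat A E \<E> \<F> \<mu>)) lam"
    by (simp add: continuous_on_eq_continuous_at)
  moreover have "det (Kmat A E \<E> \<F> lam) \<noteq> 0"
    using assms by (simp add: invertible_det_nz)
  ultimately obtain d where "d > 0" "\<forall>\<mu>. dist lam \<mu> < d \<longrightarrow> det (Kmat A E \<E> \<F> \<mu>) \<noteq> 0"
    using continuous_at_avoid[of lam "\<lambda>\<mu>. det (Kmat A E \<E> \<F> \<mu>)" 0] by blast
  then show thesis
    by (intro that[of d]) (auto simp: invertible_det_nz dist_norm norm_minus_commute)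
qed

text \<open>A nonzero numerator makes the quotient correct in the case \<open>\<bar>\<rho>\<bar> = \<infinity>\<close> too, where it is \<open>0\<close>. For a
  zero numerator \<open>rho_abs\<close> is \<open>0\<close> even if the denominator also vanishes, since division by zero gives
  \<open>0\<close>. Hence \<open>rho_abs \<noteq> 0\<close> amounts to \<open>w\<^sup>\<dagger> Q v \<noteq> 0\<close>.\<close>

lemma rho_inv_eq:
  assumes "sesq w (Qmat E \<E> \<F>) v \<noteq> 0"
  shows "rho_inv E \<E> \<F> v w = sesq w (cmat E - Qmat E \<E> \<F>) v / sesq w (Qmat E \<E> \<F>) v"
  using assms by (simp add: rho_inv_def rho_infinite_def rho_def)

lemma rho_abs_eq_0:
  assumes "sesq w (Qmat E \<E> \<F>) v = 0"
  shows "rho_abs E \<E> \<F> v w = 0"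
  using assms by (simp add: rho_abs_def rho_infinite_def rho_def)

lemma cmod_rho_inv_less_1:
  assumes "rho_abs E \<E> \<F> v w > 1"
  shows "cmod (rho_inv E \<E> \<F> v w) < 1"
proof (cases "rho_infinite E \<E> \<F> v w")
  case False
  then have "cmod (rho E \<E> \<F> v w) > 1"
    using assms by (simp add: rho_abs_def one_ereal_def)
  with False show ?thesis
    by (simp add: rho_inv_def norm_inverse inverse_less_1_iff)
qed (simp add: rho_inv_def)

text \<open>Near \<open>lam\<close> the eigenvalues of \<open>A\<^sub>r\<^sub>r + H(\<mu>)\<close> are the roots \<open>z\<close> of a determinant of the form
  treated in \<open>two_parameter_det_roots\<close>, with \<open>R = E - Q\<close>. The ratio of the two coefficients at
  \<open>(lam, lam)\<close>, in which \<open>C\<close> cancels, is \<open>\<rho>\<^sup>-\<^sup>1\<close>.\<close>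

lemma iteration_step_expansion:
  fixes A E :: "real ^ 'm ^ 'm"
    and \<E> \<F> :: "complex ^ 'n ^ 'm"
    and lam :: complex
    and v w :: "complex ^ 'm"
  assumes E_proj: "E ** E = E"
    and normalization: "hconj \<F> ** cmat E ** \<E> = mat 1"
    and K_inv: "invertible (Kmat A E \<E> \<F> lam)"
    and regular: "regular_pencil E A"
    and simple: "simple_pencil_eigenvalue E A lam"
    and right: "pencil_right_eigenvector E A lam v"
    and left: "pencil_left_eigenvector E A lam w"
    and numerator: "sesq w (Qmat E \<E> \<F>) v \<noteq> 0"
    and "c > 0"
  shows "\<exists>\<eta>>0. \<forall>\<mu> \<nu>. cmod (\<mu> - lam) < \<eta> \<and> iteration_step A E \<E> \<F> lam \<mu> \<nu> \<longrightarrow>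
           cmod ((\<nu> - lam) + rho_inv E \<E> \<F> v w * (\<mu> - lam)) \<le> c * cmod (\<mu> - lam)"
proof -
  interpret R: oblique_reduction "cmat E" "cmat A" \<E> "hconj \<F>"
    using normalization by unfold_locales (simp_all flip: cmat_times add: E_proj)
  let ?Q = "Qmat E \<E> \<F>"
  have Q: "R.Q = ?Q" by (simp add: R.Q_def Qmat_def)
  have K: "R.K \<mu> = Kmat A E \<E> \<F> \<mu>" for \<mu>
    by (simp add: R.K_def Kmat_def anticomm_def Q)
  have reduced: "R.reduced \<mu> = Arr A \<E> \<F> + Hmat A E \<E> \<F> \<mu>" for \<mu>
    by (simp add: R.reduced_def Arr_def Hmat_def Pmat_def Q K)
  define N where "N = (\<lambda>z \<mu>. pencil E A lam
    + (mat (z - lam) ** ?Q + mat (\<mu> - lam) ** (cmat E - ?Q)))"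
  have N: "R.split_pencil z \<mu> = N z \<mu>" for z \<mu>
    by (simp add: R.split_pencil_def N_def Q pencil_def vec_eq_iff mat_times_component algebra_simps)
  have N_diagonal: "N t t = pencil E A t" for t
    by (simp add: N_def pencil_def vec_eq_iff mat_times_component algebra_simps)
  obtain q where q: "\<And>t. det (pencil E A t) = (t - lam) * poly q t" "poly q lam \<noteq> 0"
    using simple_pencil_eigenvalue_factor[OF regular simple] by blast
  have "vconj w \<noteq> 0"
    using left by (auto simp: pencil_left_eigenvector_def vconj_def vec_eq_iff)
  moreover have "vconj w v* pencil E A lam = 0"
    using left by (simp add: pencil_left_eigenvector_def pencil_def
        vector_matrix_mult_diff_rdistrib vector_times_mat)
  moreover have "v \<noteq> 0" "pencil E A lam *v v = 0"
    using right by (simp_all add: pencil_right_eigenvector_def pencil_def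
        matrix_vector_mult_diff_rdistrib mat_times_vector flip: matrix_vector_mul_assoc)
  ultimately obtain a b C where cont: "continuous_on UNIV (\<lambda>(z, \<mu>). a z \<mu>)"
      "continuous_on UNIV (\<lambda>(z, \<mu>). b z \<mu>)"
    and roots: "\<And>z \<mu>. det (N z \<mu>) = 0 \<longleftrightarrow> a z \<mu> * (z - lam) + b z \<mu> * (\<mu> - lam) = 0"
    and C: "C \<noteq> 0" "a lam lam = C * sesq w ?Q v" "b lam lam = C * sesq w (cmat E - ?Q) v"
    unfolding N_def sesq_def
    by (rule two_parameter_det_roots[where q = "poly q" and lam = lam and y = "vconj w" and v = v
          and T = "pencil E A lam" and Q = ?Q and R = "cmat E - ?Q"])
       (use q N_diagonal in \<open>simp_all add: N_def\<close>)
  have "a lam lam \<noteq> 0" using C numerator by simp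
  from closest_root_expansion[OF cont this \<open>c > 0\<close>]
  obtain \<eta> where "\<eta> > 0" and \<eta>: "\<And>\<mu> \<nu>. cmod (\<mu> - lam) < \<eta> \<Longrightarrow>
       is_arg_min (\<lambda>z. cmod (z - lam)) (\<lambda>z. a z \<mu> * (z - lam) + b z \<mu> * (\<mu> - lam) = 0) \<nu> \<Longrightarrow>
       cmod (\<nu> - lam + b lam lam / a lam lam * (\<mu> - lam)) \<le> c * cmod (\<mu> - lam)"
    by blast
  have slope: "b lam lam / a lam lam = rho_inv E \<E> \<F> v w"
    using C by (simp add: rho_inv_eq[OF numerator])
  obtain d where "d > 0" and d: "\<And>\<mu>. cmod (\<mu> - lam) < d \<Longrightarrow> invertible (Kmat A E \<E> \<F> \<mu>)"
    using invertible_Kmat_near[OF K_inv] by blast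
  have step: "cmod ((\<nu> - lam) + rho_inv E \<E> \<F> v w * (\<mu> - lam)) \<le> c * cmod (\<mu> - lam)"
    if \<mu>: "cmod (\<mu> - lam) < min \<eta> d" and \<nu>: "iteration_step A E \<E> \<F> lam \<mu> \<nu>" for \<mu> \<nu>
  proof -
    have "invertible (R.K \<mu>)" using d \<mu> by (simp add: K)
    from R.eigenvalue_reduced_iff[OF this]
    have "eigenvalue (Arr A \<E> \<F> + Hmat A E \<E> \<F> \<mu>)
        = (\<lambda>z. a z \<mu> * (z - lam) + b z \<mu> * (\<mu> - lam) = 0)"
      by (simp add: fun_eq_iff eigenvalue_def right_eigenvector_def N roots flip: reduced)
    with \<nu> have "is_arg_min (\<lambda>z. cmod (z - lam))
        (\<lambda>z. a z \<mu> * (z - lam) + b z \<mu> * (\<mu> - lam) = 0) \<nu>"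
      by (simp add: iteration_step_def)
    then show ?thesis
      using \<eta>[of \<mu> \<nu>] \<mu> by (simp add: slope)
  qed
  show ?thesis
    using \<open>\<eta> > 0\<close> \<open>d > 0\<close> step by (intro exI[of _ "min \<eta> d"]) auto
qed

theorem theorem3p1:
  fixes A E :: "real ^ 'm ^ 'm"
    and \<E> \<F> :: "complex ^ 'n ^ 'm"
    and lam :: complex
    and v w :: "complex ^ 'm"
  assumes E_proj: "E ** E = E" and E_sym: "transpose E = E"
    and normalization: "hconj \<F> ** cmat E ** \<E> = mat 1"
    and K_inv: "invertible (Kmat A E \<E> \<F> lam)"
    and regular: "regular_pencil E A"
    and simple: "simple_pencil_eigenvalue E A lam"
    and right: "pencil_right_eigenvector E A lam v"
    and left: "pencil_left_eigenvector E A lam w"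
  shows "(\<exists>\<delta>>0. \<forall>l \<alpha> \<beta>.
            iteration_run A E \<E> \<F> lam l \<alpha> \<beta> \<and> cmod (l 0 - lam) < \<delta> \<and>
            rho_abs E \<E> \<F> v w > 1 \<longrightarrow>
              (\<forall>j. invertible (Kmat A E \<E> \<F> (l j))) \<and>
              l \<longlonglongrightarrow> lam \<and>
              (\<lambda>j. (l (Suc j) - lam) + rho_inv E \<E> \<F> v w * (l j - lam))
                \<in> o(\<lambda>j. l j - lam))
       \<and> (rho_abs E \<E> \<F> v w \<noteq> 0 \<longrightarrow>
            (\<forall>c>0. \<exists>\<eta>>0. \<forall>\<mu> \<nu>.
               cmod (\<mu> - lam) < \<eta> \<and> iteration_step A E \<E> \<F> lam \<mu> \<nu> \<longrightarrow>
                 cmod ((\<nu> - lam) + rho_inv E \<E> \<F> v w * (\<mu> - lam)) \<le> c * cmod (\<mu> - lam)))"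
proof -
  let ?\<kappa> = "rho_inv E \<E> \<F> v w"
  have expansion: "\<exists>\<eta>>0. \<forall>\<mu> \<nu>. cmod (\<mu> - lam) < \<eta> \<and> iteration_step A E \<E> \<F> lam \<mu> \<nu> \<longrightarrow>
      cmod ((\<nu> - lam) + ?\<kappa> * (\<mu> - lam)) \<le> c * cmod (\<mu> - lam)"
    if "rho_abs E \<E> \<F> v w \<noteq> 0" "c > 0" for c
    using that rho_abs_eq_0 iteration_step_expansion[OF E_proj normalization K_inv regular simple
        right left] by blast
  have convergence: "\<exists>\<delta>>0. \<forall>l \<alpha> \<beta>. iteration_run A E \<E> \<F> lam l \<alpha> \<beta> \<and> cmod (l 0 - lam) < \<delta> \<longrightarrow>
      (\<forall>j. invertible (Kmat A E \<E> \<F> (l j))) \<and> l \<longlonglongrightarrow> lam \<and>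
      (\<lambda>j. (l (Suc j) - lam) + ?\<kappa> * (l j - lam)) \<in> o(\<lambda>j. l j - lam)"
    if large: "rho_abs E \<E> \<F> v w > 1"
  proof -
    have "rho_abs E \<E> \<F> v w \<noteq> 0" using large by auto
    from linear_convergence[OF cmod_rho_inv_less_1[OF large], of lam "iteration_step A E \<E> \<F> lam",
        OF expansion[OF this]]
    obtain \<delta> where "\<delta> > 0" and \<delta>: "\<And>l. (\<And>j. iteration_step A E \<E> \<F> lam (l j) (l (Suc j))) \<Longrightarrow>
        cmod (l 0 - lam) < \<delta> \<Longrightarrow>
        (\<forall>j. cmod (l j - lam) \<le> cmod (l 0 - lam)) \<and> l \<longlonglongrightarrow> lam \<and>
        (\<lambda>j. (l (Suc j) - lam) + ?\<kappa> * (l j - lam)) \<in> o(\<lambda>j. l j - lam)"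
      by blast
    obtain d where "d > 0" and d: "\<And>\<mu>. cmod (\<mu> - lam) < d \<Longrightarrow> invertible (Kmat A E \<E> \<F> \<mu>)"
      using invertible_Kmat_near[OF K_inv] by blast
    show ?thesis
    proof (intro exI[of _ "min \<delta> d"] conjI allI impI; (elim conjE)?)
      show "min \<delta> d > 0" using \<open>\<delta> > 0\<close> \<open>d > 0\<close> by simp
      fix l \<alpha> \<beta>
      assume run: "iteration_run A E \<E> \<F> lam l \<alpha> \<beta>" and l0: "cmod (l 0 - lam) < min \<delta> d"
      have "cmod (l 0 - lam) < \<delta>" using l0 by simp
      from \<delta>[of l, OF _ this] run
      have *: "(\<forall>j. cmod (l j - lam) \<le> cmod (l 0 - lam)) \<and> l \<longlonglongrightarrow> lam \<and>
        (\<lambda>j. (l (Suc j) - lam) + ?\<kappa> * (l j - lam)) \<in> o(\<lambda>j. l j - lam)"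
        unfolding iteration_run_def by blast
      show "invertible (Kmat A E \<E> \<F> (l j))" for j
      proof (rule d)
        have "cmod (l j - lam) \<le> cmod (l 0 - lam)" using * by blast
        with l0 show "cmod (l j - lam) < d" by simp
      qed
      from * show "l \<longlonglongrightarrow> lam"
        "(\<lambda>j. (l (Suc j) - lam) + ?\<kappa> * (l j - lam)) \<in> o(\<lambda>j. l j - lam)"
        by blast+
    qed
  qed
  show ?thesis
  proof (cases "rho_abs E \<E> \<F> v w > 1")
    case True
    then show ?thesis using convergence expansion by blast
  next
    case False
    \<comment> \<open>Any positive radius serves, the convergence claim being conditional on \<open>\<bar>\<rho>\<bar> > 1\<close>.\<close>
    then show ?thesis using expansion by (intro conjI exI[of _ 1]) auto
  qed
qed

end
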